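(* Let $G$ be a graph with $\mu(G)=m$. Then the value of the stripe-game on $G$ with Maximizer responding (and Minimizer initiating) is at least $\lceil m/2\rceil$. Moreover this bound is sharp: for every positive integer $m$ there is a graph $G$ with $\mu(G)=m$ for which the value of the stripe-game with Maximizer responding equals $\lceil m/2\rceil$.
   Context: Graphs are finite, simple and undirected. $P_3$ is the path on three vertices; copies of $P_3$ in a graph are subgraphs, not necessarily induced. A $P_3$-packing of $G$ is a collection of vertex-disjoint copies of $P_3$ in $G$, and $\mu(G)$ is the maximum size (number of copies) of a $P_3$-packing of $G$. The stripe-game on $G$ is played by two players, Maximizer and Minimizer; throughout the game one of them is the initiator and the other is the responder. In each round, the initiator chooses a vertex $v$ of the current graph such that the current graph contains at least one copy of $P_3$ with $v$ as an end-vertex; the responder then chooses one copy of $P_3$ in the current graph with $v$ as an end-vertex; the three vertices of that copy are removed, and the next round is played on the subgraph induced by the remaining vertices. The game ends when the remaining graph contains no copy of $P_3$. Maximizer tries to maximize, and Minimizer tries to minimize, the number of copies of $P_3$ taken. The value of the game is the number of copies taken under optimal play by both players. *)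

theory Defs
  imports Complex_Main
begin

type_synonym 'a graph = "'a set \<times> 'a set set"

abbreviation verts :: "'a graph \<Rightarrow> 'a set" where
  "verts G \<equiv> fst G"

abbreviation edges :: "'a graph \<Rightarrow> 'a set set" where
  "edges G \<equiv> snd G"

definition simple_graph :: "'a graph \<Rightarrow> bool" where
  "simple_graph G \<longleftrightarrow> finite (verts G) \<and> (\<forall>e\<in>edges G. e \<subseteq> verts G \<and> card e = 2)"

definition subgraph :: "'a graph \<Rightarrow> 'a graph \<Rightarrow> bool" where
  "subgraph H G \<longleftrightarrow> verts H \<subseteq> verts G \<and> edges H \<subseteq> edges G"

definition delete_verts :: "'a graph \<Rightarrow> 'a set \<Rightarrow> 'a graph" where
  "delete_verts G X = (verts G - X, {e \<in> edges G. e \<inter> X = {}})"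

definition path3 :: "'a \<Rightarrow> 'a \<Rightarrow> 'a \<Rightarrow> 'a graph" where
  "path3 a b c = ({a, b, c}, {{a, b}, {b, c}})"

text \<open>Copies are subgraphs, not vertex sets: a triangle contains three of them, and
  \<open>path3 a b c = path3 c b a\<close> is counted once.\<close>

definition P3_copies :: "'a graph \<Rightarrow> 'a graph set" where
  "P3_copies G = {path3 a b c | a b c. distinct [a, b, c] \<and> subgraph (path3 a b c) G}"

definition P3_copies_from :: "'a graph \<Rightarrow> 'a \<Rightarrow> 'a graph set" where
  "P3_copies_from G v = {path3 v b c | b c. distinct [v, b, c] \<and> subgraph (path3 v b c) G}"

definition P3_packing :: "'a graph \<Rightarrow> 'a graph set \<Rightarrow> bool" where
  "P3_packing G P \<longleftrightarrow>
     P \<subseteq> P3_copies G \<and> (\<forall>H\<in>P. \<forall>K\<in>P. H \<noteq> K \<longrightarrow> verts H \<inter> verts K = {})"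

definition P3_packing_number :: "'a graph \<Rightarrow> nat" where
  "P3_packing_number G = Max {card P | P. P3_packing G P}"

datatype player = Maximizer | Minimizer

fun opponent :: "player \<Rightarrow> player" where
  "opponent Maximizer = Minimizer"
| "opponent Minimizer = Maximizer"

fun best :: "player \<Rightarrow> nat set \<Rightarrow> nat" where
  "best Maximizer = Max"
| "best Minimizer = Min"

definition initiator_moves :: "'a graph \<Rightarrow> 'a set" where
  "initiator_moves G = {v \<in> verts G. P3_copies_from G v \<noteq> {}}"

text \<open>The value of the stripe-game by backward induction; the first argument is the responder.
  The value for infinite vertex sets is irrelevant and only makes the function total.
  In the recursive case both sets of options are finite and nonempty, so Max and Min are meaningful.\<close>

function stripe_value :: "player \<Rightarrow> 'a graph \<Rightarrow> nat" where
  "stripe_value r G =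
     (if infinite (verts G) \<or> P3_copies G = {} then 0
      else 1 + best (opponent r)
                 ((\<lambda>v. best r ((\<lambda>H. stripe_value r (delete_verts G (verts H)))
                               ` P3_copies_from G v))
                  ` initiator_moves G))"
  by auto
termination
proof (relation "Wellfounded.measure (\<lambda>(r, G). card (verts G))")
  fix r and G :: "'a graph" and v H
  assume G: "\<not> (infinite (verts G) \<or> P3_copies G = {})" and H: "H \<in> P3_copies_from G v"
  from H have "v \<in> verts G" and "v \<in> verts H"
    by (auto simp: P3_copies_from_def subgraph_def path3_def)
  with G have "verts G - verts H \<subset> verts G" and "finite (verts G)"
    by auto
  then show "((r, delete_verts G (verts H)), (r, G)) \<in> Wellfounded.measure (\<lambda>(r, G). card (verts G))"
    by (simp add: delete_verts_def psubset_card_mono)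
qed simp

declare stripe_value.simps [simp del]

end

theory Submission
  imports Defs
begin

text \<open>
  Lower bound. Whatever vertex \<open>v\<close> Minimizer names, Maximizer can answer with a copy of
  \<open>P\<^sub>3\<close> that meets at most two members of any given packing
  (\<open>response_meeting_at_most_two\<close>): along a path \<open>v b c\<close>, if \<open>b\<close> lies in a member \<open>Q\<close> that
  avoids \<open>v\<close>, the third vertex can be rerouted to a neighbour of \<open>b\<close> inside \<open>Q\<close>, and otherwise
  \<open>b\<close> causes no hit beyond those of \<open>v\<close> and \<open>c\<close>. So the packing loses at most two members per
  round, and a packing of size \<open>m\<close> forces at least \<open>m / 2\<close> rounds.

  Sharpness. Let \<open>C\<close> be a clique that covers every edge of \<open>G\<close>. If Minimizer names a vertex \<open>v\<close>
  of \<open>C\<close>, then every answer \<open>v b c\<close> uses up a second vertex of \<open>C\<close>, because the edge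
  \<open>b c\<close> is covered. Being a clique cover is inherited by what remains of \<open>C\<close>, so the game lasts
  at most \<open>\<lceil>|C| / 2\<rceil>\<close> rounds (\<open>stripe_value_clique_cover\<close>). The clique hypothesis is
  what lets Minimizer go on naming vertices of \<open>C\<close>: a disjoint union of stars is covered by its
  centres, but no path starts at them. The complete split graph formed by a clique on
  \<open>m\<close> vertices joined to \<open>2 m\<close> independent ones has such a clique cover of size \<open>m\<close>; its packing
  number is \<open>m\<close>, since every copy of \<open>P\<^sub>3\<close> meets the cover and each clique vertex can be the
  middle of a copy with two private independent ends.
\<close>

section \<open>Copies and packings of the three-vertex path\<close>

lemma verts_path3 [simp]: "verts (path3 a b c) = {a, b, c}"
  by (simp add: path3_def)

lemma simple_graph_edgeD:
  assumes "simple_graph G" "{a, b} \<in> edges G"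
  shows "a \<in> verts G" "b \<in> verts G" "a \<noteq> b"
  using assms by (force simp: simple_graph_def)+

lemma subgraph_path3_iff:
  assumes "simple_graph G"
  shows "subgraph (path3 a b c) G \<longleftrightarrow> {a, b} \<in> edges G \<and> {b, c} \<in> edges G"
  using simple_graph_edgeD[OF assms] by (auto simp: subgraph_def path3_def)

lemma P3_copies_iff:
  assumes "simple_graph G"
  shows "H \<in> P3_copies G \<longleftrightarrow>
    (\<exists>a b c. H = path3 a b c \<and> a \<noteq> c \<and> {a, b} \<in> edges G \<and> {b, c} \<in> edges G)"
  using simple_graph_edgeD[OF assms]
  by (fastforce simp: P3_copies_def subgraph_path3_iff[OF assms])

lemma P3_copies_from_iff:
  assumes "simple_graph G"
  shows "H \<in> P3_copies_from G v \<longleftrightarrow>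
    (\<exists>b c. H = path3 v b c \<and> v \<noteq> c \<and> {v, b} \<in> edges G \<and> {b, c} \<in> edges G)"
  using simple_graph_edgeD[OF assms]
  by (fastforce simp: P3_copies_from_def subgraph_path3_iff[OF assms])

lemma initiator_moves_iff:
  assumes "simple_graph G"
  shows "v \<in> initiator_moves G \<longleftrightarrow>
    (\<exists>b c. v \<noteq> c \<and> {v, b} \<in> edges G \<and> {b, c} \<in> edges G)"
proof -
  have "v \<in> initiator_moves G \<longleftrightarrow> v \<in> verts G \<and> (\<exists>H. H \<in> P3_copies_from G v)"
    unfolding initiator_moves_def by blast
  then show ?thesis
    unfolding P3_copies_from_iff[OF assms] using simple_graph_edgeD[OF assms] by blast
qed

lemma P3_copies_from_subset: "P3_copies_from G v \<subseteq> P3_copies G"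
  by (auto simp: P3_copies_from_def P3_copies_def)

lemma finite_P3_copies:
  assumes "simple_graph G"
  shows "finite (P3_copies G)"
proof (rule finite_subset)
  show "P3_copies G \<subseteq> (\<lambda>(a, b, c). path3 a b c) ` (verts G \<times> verts G \<times> verts G)"
  proof
    fix H
    assume "H \<in> P3_copies G"
    then obtain a b c where "H = path3 a b c" "verts (path3 a b c) \<subseteq> verts G"
      unfolding P3_copies_def subgraph_def by blast
    then show "H \<in> (\<lambda>(a, b, c). path3 a b c) ` (verts G \<times> verts G \<times> verts G)"
      by (intro image_eqI[of _ _ "(a, b, c)"]) auto
  qed
  show "finite \<dots>"
    using assms by (simp add: simple_graph_def)
qed

lemma verts_delete_verts [simp]: "verts (delete_verts G X) = verts G - X"
  and edges_delete_verts [simp]: "edges (delete_verts G X) = {e \<in> edges G. e \<inter> X = {}}"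
  by (simp_all add: delete_verts_def)

lemma simple_graph_delete_verts:
  "simple_graph G \<Longrightarrow> simple_graph (delete_verts G X)"
  by (auto simp: simple_graph_def)

lemma card_verts_delete_copy:
  assumes "simple_graph G" "H \<in> P3_copies G"
  shows "card (verts (delete_verts G (verts H))) < card (verts G)"
proof (rule psubset_card_mono)
  show "finite (verts G)"
    using assms(1) by (simp add: simple_graph_def)
  obtain a b c where "H = path3 a b c" "verts (path3 a b c) \<subseteq> verts G"
    using assms(2) unfolding P3_copies_def subgraph_def by blast
  then show "verts (delete_verts G (verts H)) \<subset> verts G"
    by auto
qed

lemma P3_packing_delete_verts:
  assumes G: "simple_graph G" and P: "P3_packing G P"
  shows "P3_packing (delete_verts G X) {Q \<in> P. verts Q \<inter> X = {}}"
proof -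
  have "Q \<in> P3_copies (delete_verts G X)" if "Q \<in> P" "verts Q \<inter> X = {}" for Q
  proof -
    have "Q \<in> P3_copies G"
      using that P by (auto simp: P3_packing_def)
    then obtain a b c where Q: "Q = path3 a b c" "a \<noteq> c" "{a, b} \<in> edges G" "{b, c} \<in> edges G"
      unfolding P3_copies_iff[OF G] by blast
    then have "{a, b} \<in> edges (delete_verts G X)" "{b, c} \<in> edges (delete_verts G X)"
      using that(2) by auto
    then show ?thesis
      unfolding P3_copies_iff[OF simple_graph_delete_verts[OF G]] using Q by blast
  qed
  then show ?thesis
    using P by (auto simp: P3_packing_def)
qed

lemma finite_P3_packing:
  assumes "simple_graph G" "P3_packing G P"
  shows "finite P"
  using assms finite_subset[OF _ finite_P3_copies[OF assms(1)]] unfolding P3_packing_def by blast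

lemma finite_P3_packing_sizes:
  assumes "simple_graph G"
  shows "finite {card P | P. P3_packing G P}"
proof (rule finite_subset)
  show "{card P | P. P3_packing G P} \<subseteq> card ` Pow (P3_copies G)"
    by (auto simp: P3_packing_def)
qed (simp add: finite_P3_copies[OF assms])

lemma P3_packing_number_attained:
  assumes "simple_graph G"
  obtains P where "P3_packing G P" "card P = P3_packing_number G"
proof -
  have "P3_packing G {}"
    by (simp add: P3_packing_def)
  then have "P3_packing_number G \<in> {card P | P. P3_packing G P}"
    unfolding P3_packing_number_def by (intro Max_in finite_P3_packing_sizes assms) auto
  then show thesis
    using that by auto
qed

text \<open>Disjoint copies hit a vertex cover in distinct vertices.\<close>

lemma card_P3_packing_le_cover:
  assumes G: "simple_graph G" and P: "P3_packing G P"
    and "finite C" and cover: "\<And>e. e \<in> edges G \<Longrightarrow> e \<inter> C \<noteq> {}"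
  shows "card P \<le> card C"
proof -
  have "\<exists>x. x \<in> verts Q \<inter> C" if "Q \<in> P" for Q
  proof -
    have "Q \<in> P3_copies G"
      using that P by (auto simp: P3_packing_def)
    then obtain a b c where "Q = path3 a b c" "{a, b} \<in> edges G"
      unfolding P3_copies_iff[OF G] by blast
    then show ?thesis
      using cover[of "{a, b}"] by auto
  qed
  then obtain f where f: "\<And>Q. Q \<in> P \<Longrightarrow> f Q \<in> verts Q \<inter> C"
    by metis
  have "inj_on f P"
  proof (rule inj_onI)
    fix Q K
    assume "Q \<in> P" "K \<in> P" "f Q = f K"
    then have "verts Q \<inter> verts K \<noteq> {}"
      using f[of Q] f[of K] by auto
    then show "Q = K"
      using P \<open>Q \<in> P\<close> \<open>K \<in> P\<close> unfolding P3_packing_def by blast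
  qed
  then show ?thesis
    using f \<open>finite C\<close> by (intro card_inj_on_le[of f]) auto
qed

section \<open>One round of the game with Maximizer responding\<close>

lemma initiator_moves_nonempty:
  assumes "simple_graph G" "P3_copies G \<noteq> {}"
  shows "initiator_moves G \<noteq> {}"
proof -
  obtain H where "H \<in> P3_copies G"
    using assms(2) by blast
  then obtain a b c where "a \<noteq> c" "{a, b} \<in> edges G" "{b, c} \<in> edges G"
    unfolding P3_copies_iff[OF assms(1)] by blast
  then have "a \<in> initiator_moves G"
    unfolding initiator_moves_iff[OF assms(1)] by blast
  then show ?thesis
    by blast
qed

lemma stripe_value_no_copies: "P3_copies G = {} \<Longrightarrow> stripe_value r G = 0"
  by (subst stripe_value.simps) simp

lemma stripe_value_Maximizer:
  assumes "simple_graph G" "P3_copies G \<noteq> {}"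
  shows "stripe_value Maximizer G = Suc (Min ((\<lambda>v. Max ((\<lambda>H.
    stripe_value Maximizer (delete_verts G (verts H))) ` P3_copies_from G v)) ` initiator_moves G))"
proof -
  have "\<not> (infinite (verts G) \<or> P3_copies G = {})"
    using assms unfolding simple_graph_def by blast
  then show ?thesis
    by (subst stripe_value.simps) (simp only: if_False opponent.simps best.simps plus_1_eq_Suc)
qed

lemma finite_initiator_moves: "simple_graph G \<Longrightarrow> finite (initiator_moves G)"
  by (simp add: initiator_moves_def simple_graph_def)

lemma finite_P3_copies_from: "simple_graph G \<Longrightarrow> finite (P3_copies_from G v)"
  by (rule finite_subset[OF P3_copies_from_subset finite_P3_copies])

text \<open>To bound the value from below, give Maximizer a good answer to every vertex.\<close>

lemma stripe_value_Maximizer_ge: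
  assumes G: "simple_graph G" and ne: "P3_copies G \<noteq> {}"
    and resp: "\<And>v. v \<in> initiator_moves G \<Longrightarrow>
      \<exists>H\<in>P3_copies_from G v. n \<le> stripe_value Maximizer (delete_verts G (verts H))"
  shows "Suc n \<le> stripe_value Maximizer G"
proof -
  have "n \<le> Max ((\<lambda>H. stripe_value Maximizer (delete_verts G (verts H))) ` P3_copies_from G v)"
    if "v \<in> initiator_moves G" for v
    using resp[OF that] finite_P3_copies_from[OF G, of v] by (subst Max_ge_iff) auto
  then show ?thesis
    unfolding stripe_value_Maximizer[OF G ne]
    using finite_initiator_moves[OF G] initiator_moves_nonempty[OF G ne] by simp
qed

text \<open>To bound the value from above, give Minimizer one vertex to which all answers are bad.\<close>

lemma stripe_value_Maximizer_le:
  assumes G: "simple_graph G" and v: "v \<in> initiator_moves G"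
    and resp: "\<And>H. H \<in> P3_copies_from G v \<Longrightarrow>
      stripe_value Maximizer (delete_verts G (verts H)) \<le> n"
  shows "stripe_value Maximizer G \<le> Suc n"
proof -
  have from_v: "P3_copies_from G v \<noteq> {}"
    using v by (simp add: initiator_moves_def)
  then have ne: "P3_copies G \<noteq> {}"
    using P3_copies_from_subset by fastforce
  have "Max ((\<lambda>H. stripe_value Maximizer (delete_verts G (verts H))) ` P3_copies_from G v) \<le> n"
    using resp from_v finite_P3_copies_from[OF G, of v] by simp
  moreover have "Min ((\<lambda>v. Max ((\<lambda>H. stripe_value Maximizer (delete_verts G (verts H)))
      ` P3_copies_from G v)) ` initiator_moves G)
    \<le> Max ((\<lambda>H. stripe_value Maximizer (delete_verts G (verts H))) ` P3_copies_from G v)"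
    using finite_initiator_moves[OF G] v by (intro Min_le) auto
  ultimately show ?thesis
    unfolding stripe_value_Maximizer[OF G ne] by linarith
qed

section \<open>The lower bound\<close>

lemma card_members_meeting_le_1:
  assumes "P3_packing G P"
  shows "card {Q \<in> P. x \<in> verts Q} \<le> 1"
proof (cases "{Q \<in> P. x \<in> verts Q} = {}")
  case True
  show ?thesis
    unfolding True by simp
next
  case False
  then obtain Q where "Q \<in> P" "x \<in> verts Q"
    by blast
  then have "{Q \<in> P. x \<in> verts Q} = {Q}"
    using assms unfolding P3_packing_def by blast
  then show ?thesis
    by simp
qed

text \<open>
  A path has three vertices, each in at most one member, so the task is to save one hit: the
  middle vertex must share its member with another vertex of the path, or lie in none.
\<close>

lemma response_meeting_at_most_two:
  assumes G: "simple_graph G" and P: "P3_packing G P" and v: "v \<in> initiator_moves G"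
  obtains H where "H \<in> P3_copies_from G v" "card {Q \<in> P. verts Q \<inter> verts H \<noteq> {}} \<le> 2"
proof -
  note respond = that
  have same: "Q = K" if "Q \<in> P" "K \<in> P" "x \<in> verts Q" "x \<in> verts K" for Q K x
    using P that by (auto simp: P3_packing_def)
  have good: thesis
    if vb: "{v, b} \<in> edges G" and bc: "{b, c} \<in> edges G" and "v \<noteq> c"
      and b: "\<And>Q. Q \<in> P \<Longrightarrow> b \<in> verts Q \<Longrightarrow> v \<in> verts Q \<or> c \<in> verts Q" for b c
  proof (rule respond)
    show "path3 v b c \<in> P3_copies_from G v"
      using vb bc \<open>v \<noteq> c\<close> by (auto simp: P3_copies_from_iff[OF G])
    have "{Q \<in> P. verts Q \<inter> verts (path3 v b c) \<noteq> {}} =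
        {Q \<in> P. v \<in> verts Q} \<union> {Q \<in> P. c \<in> verts Q}"
      using b by auto
    then show "card {Q \<in> P. verts Q \<inter> verts (path3 v b c) \<noteq> {}} \<le> 2"
      using card_Un_le[of "{Q \<in> P. v \<in> verts Q}" "{Q \<in> P. c \<in> verts Q}"]
        card_members_meeting_le_1[OF P, of v] card_members_meeting_le_1[OF P, of c] by simp
  qed
  obtain b c where bc: "v \<noteq> c" "{v, b} \<in> edges G" "{b, c} \<in> edges G"
    using v by (auto simp: initiator_moves_iff[OF G])
  show thesis
  proof (cases "\<exists>Q\<in>P. b \<in> verts Q \<and> v \<notin> verts Q")
    case False
    then show thesis
      using good bc by blast
  next
    case True
    then obtain Q where Q: "Q \<in> P" "b \<in> verts Q" "v \<notin> verts Q"
      by blast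
    \<comment> \<open>Keep \<open>v b\<close> and reroute the third vertex to a neighbour \<open>d\<close> of \<open>b\<close> in \<open>Q\<close>.\<close>
    then have "Q \<in> P3_copies G"
      using P by (auto simp: P3_packing_def)
    then obtain x y z where xyz: "Q = path3 x y z" "{x, y} \<in> edges G" "{y, z} \<in> edges G"
      unfolding P3_copies_iff[OF G] by blast
    then have "{y, x} \<in> edges G" "{z, y} \<in> edges G" "b \<in> {x, y, z}"
      using Q(2) by (simp_all add: insert_commute)
    then obtain d where d: "d \<in> verts Q" "{b, d} \<in> edges G"
      using xyz by auto
    moreover have "v \<noteq> d"
      using d Q by blast
    moreover have "d \<in> verts K" if "K \<in> P" "b \<in> verts K" for K
      using same[OF that(1) Q(1) that(2) Q(2)] d(1) by simp
    ultimately show thesis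
      using good bc(2) by blast
  qed
qed

theorem card_P3_packing_le_stripe_value:
  assumes "simple_graph G" "P3_packing G P"
  shows "card P \<le> 2 * stripe_value Maximizer G"
  using assms
proof (induction "card (verts G)" arbitrary: G P rule: less_induct)
  case less
  note G = less.prems(1) and P = less.prems(2)
  show ?case
  proof (cases "P3_copies G = {}")
    case True
    then have "P = {}"
      using P by (simp add: P3_packing_def)
    then show ?thesis
      by simp
  next
    case False
    \<comment> \<open>For nonempty \<open>P\<close> this is \<open>\<lceil>|P| / 2\<rceil>\<close>, split into this round and the rest;
      truncated subtraction makes it harmless for empty \<open>P\<close>.\<close>
    have "Suc ((card P - 1) div 2) \<le> stripe_value Maximizer G"
    proof (rule stripe_value_Maximizer_ge[OF G False])
      fix v
      assume v: "v \<in> initiator_moves G"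
      obtain H where H: "H \<in> P3_copies_from G v"
        and two: "card {Q \<in> P. verts Q \<inter> verts H \<noteq> {}} \<le> 2"
        using response_meeting_at_most_two[OF G P v] .
      let ?G' = "delete_verts G (verts H)" and ?P' = "{Q \<in> P. verts Q \<inter> verts H = {}}"
      have "card ?P' \<le> 2 * stripe_value Maximizer ?G'"
      proof (rule less.hyps)
        show "card (verts ?G') < card (verts G)"
          using card_verts_delete_copy[OF G subsetD[OF P3_copies_from_subset H]] .
      qed (simp_all add: simple_graph_delete_verts P3_packing_delete_verts G P)
      moreover have "card P = card ?P' + card {Q \<in> P. verts Q \<inter> verts H \<noteq> {}}"
        using finite_P3_packing[OF G P] card_Int_Diff[of P "{Q. verts Q \<inter> verts H = {}}"]
        by (simp add: Int_def set_diff_eq)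
      ultimately have "(card P - 1) div 2 \<le> stripe_value Maximizer ?G'"
        using two by linarith
      then show "\<exists>H\<in>P3_copies_from G v.
          (card P - 1) div 2 \<le> stripe_value Maximizer (delete_verts G (verts H))"
        using H by blast
    qed
    then show ?thesis
      by linarith
  qed
qed

section \<open>Clique covers bound the value from above\<close>

text \<open>
  Each round is opened at a vertex of \<open>C\<close> and costs \<open>C\<close> two vertices, except when \<open>C\<close> is a
  single vertex; then \<open>G\<close> is a star with isolated vertices, and one round ends the game.
\<close>

theorem stripe_value_clique_cover:
  assumes "simple_graph G" "finite C"
    and "\<And>e. e \<in> edges G \<Longrightarrow> e \<inter> C \<noteq> {}"
    and "\<And>u v. u \<in> C \<Longrightarrow> v \<in> C \<Longrightarrow> u \<noteq> v \<Longrightarrow> {u, v} \<in> edges G"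
  shows "stripe_value Maximizer G \<le> (card C + 1) div 2"
  using assms
proof (induction "card (verts G)" arbitrary: G C rule: less_induct)
  case less
  note G = less.prems(1) and fin = less.prems(2) and cover = less.prems(3)
    and clique = less.prems(4)
  have rest: "stripe_value Maximizer (delete_verts G (verts H)) \<le> (card (C - verts H) + 1) div 2"
    if H: "H \<in> P3_copies_from G v" for H v
  proof (rule less.hyps)
    show "card (verts (delete_verts G (verts H))) < card (verts G)"
      using card_verts_delete_copy[OF G subsetD[OF P3_copies_from_subset H]] .
    show "e \<inter> (C - verts H) \<noteq> {}" if "e \<in> edges (delete_verts G (verts H))" for e
      using that cover by fastforce
    show "{x, y} \<in> edges (delete_verts G (verts H))"
      if "x \<in> C - verts H" "y \<in> C - verts H" "x \<noteq> y" for x y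
      using that clique by auto
  qed (simp_all add: simple_graph_delete_verts G fin)
  show ?case
  proof (cases "P3_copies G = {}")
    case True
    then show ?thesis
      by (simp add: stripe_value_no_copies)
  next
    case False
    then obtain a b c where abc: "a \<noteq> c" "{a, b} \<in> edges G" "{b, c} \<in> edges G"
      using P3_copies_iff[OF G] by blast
    show ?thesis
    proof (cases "\<exists>v\<in>C. v \<in> initiator_moves G")
      case True
      then obtain v where v: "v \<in> C" "v \<in> initiator_moves G"
        by blast
      have lose_two: "card (C - verts H) + 2 \<le> card C" if H: "H \<in> P3_copies_from G v" for H
      proof -
        obtain x y where xy: "H = path3 v x y" "v \<noteq> y" "{v, x} \<in> edges G" "{x, y} \<in> edges G"
          using H by (auto simp: P3_copies_from_iff[OF G])
        then obtain w where w: "w \<in> C" "w \<in> {x, y}"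
          using cover[of "{x, y}"] by blast
        then have "v \<noteq> w"
          using xy simple_graph_edgeD[OF G] by blast
        then have "card {v, w} = 2"
          by simp
        moreover have "C - verts H \<subseteq> C - {v, w}"
          using xy w by auto
        then have "card (C - verts H) \<le> card (C - {v, w})"
          using fin by (intro card_mono) auto
        moreover have "card (C - {v, w}) = card C - card {v, w}"
          using v w by (intro card_Diff_subset) auto
        moreover have "card {v, w} \<le> card C"
          using v w fin by (intro card_mono) auto
        ultimately show ?thesis
          by linarith
      qed
      have "stripe_value Maximizer G \<le> Suc ((card C - 1) div 2)"
      proof (rule stripe_value_Maximizer_le[OF G v(2)])
        fix H
        assume H: "H \<in> P3_copies_from G v"
        show "stripe_value Maximizer (delete_verts G (verts H)) \<le> (card C - 1) div 2"
          using rest[OF H] lose_two[OF H] by linarith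
      qed
      moreover have "card C \<noteq> 0"
        using v(1) fin by auto
      ultimately show ?thesis
        by linarith
    next
      case False
      have a: "a \<in> initiator_moves G"
        using abc unfolding initiator_moves_iff[OF G] by blast
      then have "a \<notin> C"
        using False by blast
      then have "b \<in> C"
        using cover[OF abc(2)] by blast
      \<comment> \<open>Another vertex \<open>w\<close> of the clique would start the path \<open>w b a\<close>.\<close>
      have "w = b" if "w \<in> C" for w
      proof (rule ccontr)
        assume "w \<noteq> b"
        then have "{w, b} \<in> edges G"
          using clique that \<open>b \<in> C\<close> by blast
        moreover have "{b, a} \<in> edges G"
          using abc by (simp add: insert_commute)
        moreover have "w \<noteq> a"
          using that \<open>a \<notin> C\<close> by blast
        ultimately have "w \<in> initiator_moves G"
          unfolding initiator_moves_iff[OF G] by blast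
        then show False
          using False that by blast
      qed
      then have C: "C = {b}"
        using \<open>b \<in> C\<close> by blast
      have "stripe_value Maximizer G \<le> Suc 0"
      proof (rule stripe_value_Maximizer_le[OF G a])
        fix H
        assume H: "H \<in> P3_copies_from G a"
        then obtain x y where "H = path3 a x y" "{a, x} \<in> edges G"
          unfolding P3_copies_from_iff[OF G] by blast
        then have "C - verts H = {}"
          using C cover[of "{a, x}"] by auto
        then have "card (C - verts H) = 0"
          by (simp only: card.empty)
        then show "stripe_value Maximizer (delete_verts G (verts H)) \<le> 0"
          using rest[OF H] by linarith
      qed
      then show ?thesis
        using C by simp
    qed
  qed
qed

section \<open>The complete split graph\<close>

definition complete_split_graph :: "nat \<Rightarrow> nat graph" where
  "complete_split_graph m = ({..<3 * m}, {{u, v} | u v. u < m \<and> v < 3 * m \<and> u \<noteq> v})"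

lemma simple_complete_split_graph: "simple_graph (complete_split_graph m)"
  by (auto simp: simple_graph_def complete_split_graph_def)

lemma complete_split_graph_cover:
  "e \<in> edges (complete_split_graph m) \<Longrightarrow> e \<inter> {..<m} \<noteq> {}"
  by (auto simp: complete_split_graph_def)

lemma P3_packing_number_complete_split_graph:
  "P3_packing_number (complete_split_graph m) = m"
proof -
  let ?G = "complete_split_graph m" and ?P = "(\<lambda>i. path3 (m + i) i (2 * m + i)) ` {..<m}"
  note G = simple_complete_split_graph[of m]
  have edge: "{i, j} \<in> edges ?G" "{j, i} \<in> edges ?G" if "i < m" "j < 3 * m" "i \<noteq> j" for i j
    using that by (auto simp: complete_split_graph_def)
  have P: "P3_packing ?G ?P"
    unfolding P3_packing_def
  proof (intro conjI ballI impI)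
    show "?P \<subseteq> P3_copies ?G"
    proof
      fix H
      assume "H \<in> ?P"
      then obtain i where i: "i < m" and H: "H = path3 (m + i) i (2 * m + i)"
        by blast
      have "{m + i, i} \<in> edges ?G" "{i, 2 * m + i} \<in> edges ?G" "m + i \<noteq> 2 * m + i"
        using i edge[of i "m + i"] edge[of i "2 * m + i"] by auto
      then show "H \<in> P3_copies ?G"
        unfolding P3_copies_iff[OF G] H by blast
    qed
    show "verts H \<inter> verts K = {}" if "H \<in> ?P" "K \<in> ?P" "H \<noteq> K" for H K
      using that by auto
  qed
  have "inj_on (\<lambda>i. path3 (m + i) i (2 * m + i)) {..<m}"
  proof (rule inj_onI)
    fix i j
    assume "i \<in> {..<m}" "j \<in> {..<m}" "path3 (m + i) i (2 * m + i) = path3 (m + j) j (2 * m + j)"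
    then have "i \<in> {m + j, j, 2 * m + j}" "i < m"
      by (metis insertCI verts_path3, simp)
    then show "i = j"
      by auto
  qed
  then have "card ?P = m"
    by (simp add: card_image)
  moreover have "card Q \<le> m" if "P3_packing ?G Q" for Q
    using card_P3_packing_le_cover[OF G that finite_lessThan complete_split_graph_cover] by simp
  ultimately show ?thesis
    unfolding P3_packing_number_def using P
    by (intro Max_eqI finite_P3_packing_sizes[OF G]) (blast, metis (mono_tags, lifting) mem_Collect_eq)
qed

section \<open>The value of the game\<close>

lemma ceiling_half: "\<lceil>real m / 2\<rceil> = int ((m + 1) div 2)"
  by linarith

theorem half_packing_number_le_stripe_value:
  assumes "simple_graph G"
  shows "\<lceil>real (P3_packing_number G) / 2\<rceil> \<le> int (stripe_value Maximizer G)"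
proof -
  obtain P where "P3_packing G P" "card P = P3_packing_number G"
    using P3_packing_number_attained[OF assms] .
  then have "P3_packing_number G \<le> 2 * stripe_value Maximizer G"
    using card_P3_packing_le_stripe_value[OF assms] by metis
  then show ?thesis
    unfolding ceiling_half by linarith
qed

lemma stripe_value_complete_split_graph:
  "int (stripe_value Maximizer (complete_split_graph m)) = \<lceil>real m / 2\<rceil>"
proof (rule antisym)
  have "stripe_value Maximizer (complete_split_graph m) \<le> (card {..<m} + 1) div 2"
  proof (rule stripe_value_clique_cover)
    show "{u, v} \<in> edges (complete_split_graph m)" if "u \<in> {..<m}" "v \<in> {..<m}" "u \<noteq> v" for u v
      using that by (fastforce simp: complete_split_graph_def)
  qed (use simple_complete_split_graph complete_split_graph_cover in auto)
  then show "int (stripe_value Maximizer (complete_split_graph m)) \<le> \<lceil>real m / 2\<rceil>"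
    unfolding ceiling_half by simp
  show "\<lceil>real m / 2\<rceil> \<le> int (stripe_value Maximizer (complete_split_graph m))"
    using half_packing_number_le_stripe_value[OF simple_complete_split_graph, of m]
    by (simp add: P3_packing_number_complete_split_graph)
qed

theorem lemma4:
  "(\<forall>(G :: 'a graph) m.
      simple_graph G \<and> P3_packing_number G = m \<longrightarrow>
        \<lceil>real m / 2\<rceil> \<le> int (stripe_value Maximizer G)) \<and>
   (\<forall>m\<ge>1. \<exists>G :: nat graph.
      simple_graph G \<and> P3_packing_number G = m \<and>
        int (stripe_value Maximizer G) = \<lceil>real m / 2\<rceil>)"
  using half_packing_number_le_stripe_value simple_complete_split_graph
    P3_packing_number_complete_split_graph stripe_value_complete_split_graph
  by blast

end
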